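(* Let $G$ be a finite group. Then $P(G)$ is a firefly-type graph if and only if the set of orders of the non-identity elements of $G$ is exactly $\{2,3\}$.
   Context: The power graph $P(G)$ of a finite group $G$ is the simple graph with vertex set $G$ in which two distinct vertices $u,v$ are adjacent if and only if $u\in\langle v\rangle$ or $v\in\langle u\rangle$. For integers $1\le p\le n-1$, the firefly-type graph $F_{p,n-p}$ is $K_1\vee\left(pK_1\cup(n-p)K_2\right)$: a single vertex joined to all vertices of the disjoint union of $p$ copies of $K_1$ and $n-p$ copies of $K_2$. A graph is a firefly-type graph if it is isomorphic to $F_{p,n-p}$ for some integers $1\le p\le n-1$. *)

theory Defs
  imports
    "HOL-Algebra.Algebra"
    "Graph_Theory.Graph_Theory"
begin

text \<open>
  A simple graph is represented as a \<^locale>\<open>pair_graph\<close>, that is, a finite symmetric loop-free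
  digraph without parallel arcs; an edge joining \<open>u\<close> and \<open>v\<close> is the pair of arcs
  \<open>(u, v)\<close> and \<open>(v, u)\<close>. For such graphs \<^const>\<open>digraph_iso\<close> is isomorphism of simple graphs.
\<close>

definition power_graph :: "('a, 'b) monoid_scheme \<Rightarrow> 'a pair_pre_digraph" where
  "power_graph G =
    \<lparr> pverts = carrier G,
      parcs = {(u, v). u \<in> carrier G \<and> v \<in> carrier G \<and> u \<noteq> v \<and>
                 (u \<in> generate G {v} \<or> v \<in> generate G {u})} \<rparr>"

definition complete_graph :: "nat \<Rightarrow> nat pair_pre_digraph" where
  "complete_graph n =
    \<lparr> pverts = {..<n}, parcs = {(i, j). i < n \<and> j < n \<and> i \<noteq> j} \<rparr>"

definition graph_union ::
    "'a pair_pre_digraph \<Rightarrow> 'b pair_pre_digraph \<Rightarrow> ('a + 'b) pair_pre_digraph" where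
  "graph_union A B =
    \<lparr> pverts = pverts A <+> pverts B,
      parcs = {(Inl u, Inl v) | u v. (u, v) \<in> parcs A}
        \<union> {(Inr u, Inr v) | u v. (u, v) \<in> parcs B} \<rparr>"

definition graph_join ::
    "'a pair_pre_digraph \<Rightarrow> 'b pair_pre_digraph \<Rightarrow> ('a + 'b) pair_pre_digraph" where
  "graph_join A B =
    \<lparr> pverts = pverts A <+> pverts B,
      parcs = parcs (graph_union A B)
        \<union> (Inl ` pverts A) \<times> (Inr ` pverts B) \<union> (Inr ` pverts B) \<times> (Inl ` pverts A) \<rparr>"

definition graph_copies :: "nat \<Rightarrow> 'a pair_pre_digraph \<Rightarrow> (nat \<times> 'a) pair_pre_digraph" where
  "graph_copies m A =
    \<lparr> pverts = {..<m} \<times> pverts A,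
      parcs = {((i, u), (j, v)). i < m \<and> i = j \<and> (u, v) \<in> parcs A} \<rparr>"

definition firefly_graph ::
    "nat \<Rightarrow> nat \<Rightarrow> (nat + nat \<times> nat + nat \<times> nat) pair_pre_digraph" where
  "firefly_graph p q =
    graph_join (complete_graph 1)
      (graph_union (graph_copies p (complete_graph 1)) (graph_copies q (complete_graph 2)))"

definition firefly_type :: "'a pair_pre_digraph \<Rightarrow> bool" where
  "firefly_type A \<longleftrightarrow>
    (\<exists>n p. 1 \<le> p \<and> p \<le> n - 1 \<and>
       digraph_iso (with_proj A) (with_proj (firefly_graph p (n - p))))"

lemma pair_graph_power_graph:
  assumes "finite (carrier G)"
  shows "pair_graph (power_graph G)"
proof -
  have "finite (parcs (power_graph G))"
    by (rule finite_subset[of _ "carrier G \<times> carrier G"])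
       (use assms in \<open>auto simp: power_graph_def\<close>)
  then show ?thesis
    using assms
    by unfold_locales (auto simp: power_graph_def symmetric_def intro: symI)
qed

lemma complete_digraph_complete_graph:
  "complete_digraph n (with_proj (complete_graph n))"
  by (auto simp: complete_digraph_pair_def complete_graph_def)

lemma pair_graph_complete_graph: "pair_graph (complete_graph n)"
  by (rule pair_graphI_complete[OF complete_digraph_complete_graph])

lemma pair_graph_iff:
  "pair_graph A \<longleftrightarrow> finite (pverts A) \<and> parcs A \<subseteq> pverts A \<times> pverts A \<and>
    sym (parcs A) \<and> irrefl (parcs A)"
proof
  assume "pair_graph A"
  then interpret pair_graph A .
  have "sym (parcs A)"
    using pair_sym_arcs by (simp add: symmetric_def)
  moreover have "(a, a) \<notin> parcs A" for a
    using pair_no_loops[of "(a, a)"] by auto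
  ultimately show "finite (pverts A) \<and> parcs A \<subseteq> pverts A \<times> pverts A \<and> sym (parcs A) \<and>
      irrefl (parcs A)"
    using pair_finite_verts in_arcsD1 in_arcsD2 unfolding irrefl_def by auto
next
  assume A: "finite (pverts A) \<and> parcs A \<subseteq> pverts A \<times> pverts A \<and> sym (parcs A) \<and> irrefl (parcs A)"
  then have "finite (parcs A)"
    by (meson finite_SigmaI finite_subset)
  with A show "pair_graph A"
    by unfold_locales (auto simp: symmetric_def irrefl_def)
qed

lemma pair_graph_union:
  assumes "pair_graph A" "pair_graph B"
  shows "pair_graph (graph_union A B)"
  using assms unfolding pair_graph_iff graph_union_def sym_def irrefl_def
  by auto

lemma pair_graph_join:
  assumes "pair_graph A" "pair_graph B"
  shows "pair_graph (graph_join A B)"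
  using pair_graph_union[OF assms] assms
  unfolding pair_graph_iff graph_join_def sym_def irrefl_def
  by (auto simp: graph_union_def)

lemma pair_graph_copies:
  assumes "pair_graph A"
  shows "pair_graph (graph_copies m A)"
  using assms unfolding pair_graph_iff graph_copies_def sym_def irrefl_def
  by auto

lemma pair_graph_firefly: "pair_graph (firefly_graph p q)"
  unfolding firefly_graph_def
  by (intro pair_graph_join pair_graph_union pair_graph_copies pair_graph_complete_graph)

lemma digraph_iso_pair_graph_iff:
  assumes "pair_graph A" "pair_graph B"
  shows "digraph_iso (with_proj A) (with_proj B) \<longleftrightarrow>
    (\<exists>f. bij_betw f (pverts A) (pverts B) \<and>
      (\<forall>u\<in>pverts A. \<forall>v\<in>pverts A. (u, v) \<in> parcs A \<longleftrightarrow> (f u, f v) \<in> parcs B))"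
proof -
  interpret A: pair_graph A by fact
  interpret B: pair_graph B by fact
  show ?thesis
  proof
    assume "digraph_iso (with_proj A) (with_proj B)"
    then obtain h where h: "A.digraph_isomorphism h" and B: "with_proj B = app_iso h (with_proj A)"
      unfolding digraph_iso_def by blast
    let ?f = "iso_verts h"
    from h have inj: "inj_on ?f (pverts A)"
      and ends: "\<And>a. a \<in> parcs A \<Longrightarrow>
        ?f (fst a) = iso_tail h (iso_arcs h a) \<and> ?f (snd a) = iso_head h (iso_arcs h a)"
      by (auto simp: A.digraph_isomorphism_def)
    from arg_cong[OF B, of verts] have verts: "pverts B = ?f ` pverts A" by simp
    from arg_cong[OF B, of arcs] have arcs: "parcs B = iso_arcs h ` parcs A" by simp
    from arg_cong[OF B, of tail] arg_cong[OF B, of head]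
    have "iso_tail h = fst" "iso_head h = snd" by simp_all
    then have arc: "iso_arcs h (u, v) = (?f u, ?f v)" if "(u, v) \<in> parcs A" for u v
      using ends[OF that] by (simp add: prod_eq_iff)
    have "(u, v) \<in> parcs A" if "u \<in> pverts A" "v \<in> pverts A" "(?f u, ?f v) \<in> parcs B" for u v
    proof -
      from that(3) arcs obtain x y where xy: "(x, y) \<in> parcs A" "(?f u, ?f v) = iso_arcs h (x, y)"
        by auto
      then have "?f u = ?f x" "?f v = ?f y" using arc by auto
      then have "u = x" "v = y"
        using inj that A.in_arcsD1[OF xy(1)] A.in_arcsD2[OF xy(1)] by (auto dest: inj_onD)
      with xy show ?thesis by simp
    qed
    moreover have "(?f u, ?f v) \<in> parcs B" if "(u, v) \<in> parcs A" for u v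
      using arc[OF that] that arcs by (metis imageI)
    ultimately show "\<exists>f. bij_betw f (pverts A) (pverts B) \<and>
      (\<forall>u\<in>pverts A. \<forall>v\<in>pverts A. (u, v) \<in> parcs A \<longleftrightarrow> (f u, f v) \<in> parcs B)"
      using inj verts unfolding bij_betw_def by blast
  next
    assume "\<exists>f. bij_betw f (pverts A) (pverts B) \<and>
      (\<forall>u\<in>pverts A. \<forall>v\<in>pverts A. (u, v) \<in> parcs A \<longleftrightarrow> (f u, f v) \<in> parcs B)"
    then obtain f where inj: "inj_on f (pverts A)" and im: "pverts B = f ` pverts A"
      and iff: "\<And>u v. u \<in> pverts A \<Longrightarrow> v \<in> pverts A \<Longrightarrow>
        (u, v) \<in> parcs A \<longleftrightarrow> (f u, f v) \<in> parcs B"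
      unfolding bij_betw_def by blast
    let ?h = "\<lparr> iso_verts = f, iso_arcs = map_prod f f, iso_head = snd, iso_tail = fst \<rparr>"
    have "inj_on (map_prod f f) (pverts A \<times> pverts A)"
      using inj by (intro map_prod_inj_on)
    moreover have "parcs A \<subseteq> pverts A \<times> pverts A"
      using A.in_arcsD1 A.in_arcsD2 by auto
    ultimately have "inj_on (map_prod f f) (parcs A)"
      by (rule inj_on_subset)
    then have "A.digraph_isomorphism ?h"
      using inj A.wf_digraph_axioms by (auto simp: A.digraph_isomorphism_def)
    moreover have "parcs B = map_prod f f ` parcs A"
    proof (intro equalityI subsetI)
      fix e assume e: "e \<in> parcs B"
      obtain x y where xy: "e = (x, y)" by (cases e)
      with e im B.in_arcsD1 B.in_arcsD2 obtain u v
        where "u \<in> pverts A" "v \<in> pverts A" "x = f u" "y = f v" by blast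
      then show "e \<in> map_prod f f ` parcs A"
        using iff e xy by (auto intro!: image_eqI[of _ _ "(u, v)"])
    next
      fix e assume "e \<in> map_prod f f ` parcs A"
      then obtain u v where uv: "(u, v) \<in> parcs A" "e = (f u, f v)"
        by auto
      show "e \<in> parcs B"
        using iff[OF A.in_arcsD1[OF uv(1)] A.in_arcsD2[OF uv(1)]] uv by simp
    qed
    ultimately show "digraph_iso (with_proj A) (with_proj B)"
      unfolding digraph_iso_def using im
      by (intro exI[of _ ?h]) (simp add: app_iso_def with_proj_def)
  qed
qed

end

theory Submission
  imports Defs
begin

text \<open>
  A firefly-type graph is one with a vertex \<open>c\<close> adjacent to all others whose removal leaves
  isolated vertices and isolated edges, at least one of each; this is \<open>firefly_type_iff\<close>, which
  removes all mention of explicit isomorphisms.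

  In a power graph the identity is adjacent to everything. A firefly has only one such vertex:
  it has at least four vertices, so a vertex other than \<open>c\<close>, having at most two neighbours, misses
  one of them. Hence \<open>c\<close> is the identity. A non-identity \<open>x\<close> is adjacent to all other non-identity
  elements of \<open>\<langle>x\<rangle>\<close>, so being left with at most one neighbour after the identity is removed forces
  \<open>\<langle>x\<rangle>\<close> to have order 2 or 3. An isolated vertex comes from an involution, since an element of
  order 3 is adjacent to its inverse, and an isolated edge comes from an element of order 3, since
  \<open>\<langle>x\<rangle>\<close> contains nothing but the identity and \<open>x\<close> when \<open>x\<close> is an involution.

  Conversely, if all non-identity elements have order 2 or 3, then \<open>\<langle>x\<rangle> = {1, x, x\<^sup>-\<^sup>1}\<close>, so the only
  possible edge at \<open>x\<close> avoiding the identity joins \<open>x\<close> to its inverse (\<open>power_graph_arc_iff_inv\<close>).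
  Involutions become the isolated vertices, pairs of mutually inverse elements of order 3 the
  isolated edges.
\<close>

section \<open>An intrinsic description of firefly-type graphs\<close>

lemma pverts_firefly_graph:
  "pverts (firefly_graph p q) =
    {Inl 0} \<union> (\<lambda>i. Inr (Inl (i, 0))) ` {..<p} \<union> (\<lambda>x. Inr (Inr x)) ` ({..<q} \<times> {..<2})"
  by (auto simp: firefly_graph_def graph_join_def graph_union_def graph_copies_def
      complete_graph_def)

lemma parcs_firefly_graph_simps:
  "(Inl a, Inl b) \<notin> parcs (firefly_graph p q)"
  "(Inl a, Inr y) \<in> parcs (firefly_graph p q) \<longleftrightarrow> a = 0 \<and> Inr y \<in> pverts (firefly_graph p q)"
  "(Inr y, Inl a) \<in> parcs (firefly_graph p q) \<longleftrightarrow> a = 0 \<and> Inr y \<in> pverts (firefly_graph p q)"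
  "(Inr (Inl x), Inr y) \<notin> parcs (firefly_graph p q)"
  "(Inr y, Inr (Inl x)) \<notin> parcs (firefly_graph p q)"
  "(Inr (Inr (i, s)), Inr (Inr (j, t))) \<in> parcs (firefly_graph p q) \<longleftrightarrow>
    i < q \<and> i = j \<and> s < 2 \<and> t < 2 \<and> s \<noteq> t"
  by (auto simp: firefly_graph_def graph_join_def graph_union_def graph_copies_def
      complete_graph_def)

definition firefly_centre :: "'a pair_pre_digraph \<Rightarrow> 'a \<Rightarrow> bool" where
  "firefly_centre A c \<longleftrightarrow>
    c \<in> pverts A \<and>
    (\<forall>v \<in> pverts A - {c}. (c, v) \<in> parcs A) \<and>
    (\<forall>v u w. {v, u, w} \<subseteq> pverts A - {c} \<and> (v, u) \<in> parcs A \<and> (v, w) \<in> parcs A \<longrightarrow> u = w) \<and>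
    (\<exists>v \<in> pverts A - {c}. \<forall>w \<in> pverts A - {c}. (v, w) \<notin> parcs A) \<and>
    (\<exists>u \<in> pverts A - {c}. \<exists>v \<in> pverts A - {c}. (u, v) \<in> parcs A)"

lemma firefly_centre_firefly_graph:
  assumes "1 \<le> p" "1 \<le> q"
  shows "firefly_centre (firefly_graph p q) (Inl 0)"
proof -
  have "\<forall>v u w. {v, u, w} \<subseteq> pverts (firefly_graph p q) - {Inl 0} \<and>
      (v, u) \<in> parcs (firefly_graph p q) \<and> (v, w) \<in> parcs (firefly_graph p q) \<longrightarrow> u = w"
    by (auto simp: pverts_firefly_graph parcs_firefly_graph_simps less_2_cases_iff)
  moreover have "\<exists>v \<in> pverts (firefly_graph p q) - {Inl 0}.
      \<forall>w \<in> pverts (firefly_graph p q) - {Inl 0}. (v, w) \<notin> parcs (firefly_graph p q)"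
    using assms(1)
    by (intro bexI[of _ "Inr (Inl (0, 0))"])
      (auto simp: pverts_firefly_graph parcs_firefly_graph_simps)
  moreover have "\<exists>u \<in> pverts (firefly_graph p q) - {Inl 0}.
      \<exists>v \<in> pverts (firefly_graph p q) - {Inl 0}. (u, v) \<in> parcs (firefly_graph p q)"
    using assms(2)
    by (intro bexI[of _ "Inr (Inr (0, 0))"] bexI[of _ "Inr (Inr (0, 1))"])
      (auto simp: pverts_firefly_graph parcs_firefly_graph_simps)
  moreover have "Inl 0 \<in> pverts (firefly_graph p q)"
    and "\<forall>v \<in> pverts (firefly_graph p q) - {Inl 0}. (Inl 0, v) \<in> parcs (firefly_graph p q)"
    by (auto simp: pverts_firefly_graph parcs_firefly_graph_simps)
  ultimately show ?thesis
    unfolding firefly_centre_def by (intro conjI)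
qed

lemma firefly_centre_iso:
  assumes bij: "bij_betw f (pverts A) (pverts B)"
    and arcs: "\<And>u v. u \<in> pverts A \<Longrightarrow> v \<in> pverts A \<Longrightarrow>
      (u, v) \<in> parcs A \<longleftrightarrow> (f u, f v) \<in> parcs B"
    and c: "c \<in> pverts A" and B: "firefly_centre B (f c)"
  shows "firefly_centre A c"
proof -
  have im: "f ` (pverts A - {c}) = pverts B - {f c}"
    using bij c by (auto simp: bij_betw_def dest: inj_onD)
  have inj: "inj_on f (pverts A)"
    using bij by (simp add: bij_betw_def)
  have "u = w" if "{v, u, w} \<subseteq> pverts A - {c}" "(v, u) \<in> parcs A" "(v, w) \<in> parcs A" for v u w
  proof -
    have "{f v, f u, f w} \<subseteq> pverts B - {f c}"
      using that(1) im by blast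
    moreover have "(f v, f u) \<in> parcs B" "(f v, f w) \<in> parcs B"
      using that arcs by auto
    ultimately have "f u = f w"
      using B unfolding firefly_centre_def by blast
    then show ?thesis
      using that(1) inj by (auto dest: inj_onD)
  qed
  moreover have "\<exists>v \<in> pverts A - {c}. \<forall>w \<in> pverts A - {c}. (v, w) \<notin> parcs A"
  proof -
    have "\<exists>v \<in> f ` (pverts A - {c}). \<forall>w \<in> f ` (pverts A - {c}). (v, w) \<notin> parcs B"
      unfolding im using B unfolding firefly_centre_def by blast
    then show ?thesis using arcs by blast
  qed
  moreover have "\<exists>u \<in> pverts A - {c}. \<exists>v \<in> pverts A - {c}. (u, v) \<in> parcs A"
  proof -
    have "\<exists>u \<in> f ` (pverts A - {c}). \<exists>v \<in> f ` (pverts A - {c}). (u, v) \<in> parcs B"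
      unfolding im using B unfolding firefly_centre_def by blast
    then show ?thesis using arcs by blast
  qed
  moreover have "\<forall>v \<in> pverts A - {c}. (c, v) \<in> parcs A"
  proof -
    have "\<forall>v \<in> f ` (pverts A - {c}). (f c, v) \<in> parcs B"
      unfolding im using B unfolding firefly_centre_def by blast
    then show ?thesis using arcs c by blast
  qed
  ultimately show ?thesis
    unfolding firefly_centre_def using c by blast
qed

text \<open>
  The isomorphism is built by numbering. Each vertex \<open>v\<close> off the centre has its block, consisting
  of \<open>v\<close> and its neighbours off the centre. These blocks are the components left when the centre
  is removed: they have one or two elements, and two distinct vertices are adjacent exactly if
  they share a block. The \<open>p\<close> isolated vertices and the \<open>q\<close> two-element blocks are numbered, and a
  choice of one element per block tells the two ends of an edge apart.
\<close>
lemma iso_firefly_graph_if_firefly_centre: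
  assumes A: "pair_graph A" and c: "firefly_centre A c"
  obtains p q where "1 \<le> p" "1 \<le> q" "digraph_iso (with_proj A) (with_proj (firefly_graph p q))"
proof -
  let ?V = "pverts A - {c}" and ?E = "parcs A"
  have fin: "finite ?V" and sym: "sym ?E" and irr: "irrefl ?E"
    using A by (auto simp: pair_graph_iff)
  have cV: "c \<in> pverts A"
    and dom: "\<And>v. v \<in> ?V \<Longrightarrow> (c, v) \<in> ?E \<and> (v, c) \<in> ?E"
    and uniq: "\<And>v u w. v \<in> ?V \<Longrightarrow> u \<in> ?V \<Longrightarrow> w \<in> ?V \<Longrightarrow> (v, u) \<in> ?E \<Longrightarrow> (v, w) \<in> ?E \<Longrightarrow> u = w"
    using c symD[OF sym] unfolding firefly_centre_def by blast+
  define L where "L = {v \<in> ?V. \<forall>w \<in> ?V. (v, w) \<notin> ?E}"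
  define T where "T = ?V - L"
  define block where "block v = insert v {w \<in> ?V. (v, w) \<in> ?E}" for v
  have T: "\<exists>w \<in> T. w \<noteq> v \<and> (v, w) \<in> ?E \<and> block v = {v, w} \<and> block w = {v, w}" if "v \<in> T" for v
  proof -
    from that obtain w where w: "v \<in> ?V" "w \<in> ?V" "(v, w) \<in> ?E"
      unfolding T_def L_def by blast
    with sym have wv: "(w, v) \<in> ?E" by (auto dest: symD)
    have "v \<noteq> w" using w irr by (auto simp: irrefl_def)
    moreover have "w \<in> T" using w wv unfolding T_def L_def by blast
    moreover have "block v = {v, w}" using w uniq unfolding block_def by blast
    moreover have "block w = {v, w}" using w wv uniq unfolding block_def by blast
    ultimately show ?thesis using w(3) by (intro bexI[of _ w]) auto
  qed
  have block_T: "(u, v) \<in> ?E \<longleftrightarrow> u \<noteq> v \<and> block u = block v" if u: "u \<in> T" and v: "v \<in> T" for u v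
  proof -
    from T[OF u] obtain w where w: "w \<in> T" "w \<noteq> u" "(u, w) \<in> ?E" "block u = {u, w}" "block w = {u, w}"
      by blast
    have "v \<in> block v" by (simp add: block_def)
    show ?thesis
    proof
      assume uv: "(u, v) \<in> ?E"
      then have "w = v"
        using uniq[of u w v] u v w by (auto simp: T_def)
      with w show "u \<noteq> v \<and> block u = block v" by simp
    next
      assume "u \<noteq> v \<and> block u = block v"
      with w \<open>v \<in> block v\<close> have "v = w" by auto
      with w show "(u, v) \<in> ?E" by simp
    qed
  qed
  define rep where "rep S = (SOME y. y \<in> S)" for S :: "'a set"
  have rep: "rep (block v) \<in> block v" for v
    unfolding rep_def by (rule someI[of _ v]) (simp add: block_def)
  have "finite L" "finite (block ` T)"
    using fin by (auto simp: L_def T_def)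
  then obtain i j where i: "bij_betw i L {..<card L}" and j: "bij_betw j (block ` T) {..<card (block ` T)}"
    using ex_bij_betw_finite_nat unfolding atLeast0LessThan by metis
  let ?p = "card L" and ?q = "card (block ` T)"
  define f :: "'a \<Rightarrow> nat + nat \<times> nat + nat \<times> nat"
    where "f v = (if v = c then Inl 0 else if v \<in> L then Inr (Inl (i v, 0))
     else Inr (Inr (j (block v), if v = rep (block v) then 0 else 1)))" for v
  have f_c: "f c = Inl 0"
    and f_L: "\<And>v. v \<in> L \<Longrightarrow> f v = Inr (Inl (i v, 0))"
    and f_T: "\<And>v. v \<in> T \<Longrightarrow> f v = Inr (Inr (j (block v), if v = rep (block v) then 0 else 1))"
    unfolding f_def T_def L_def by auto
  have V: "pverts A = insert c (L \<union> T)" and disj: "c \<notin> L" "c \<notin> T" "L \<inter> T = {}"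
    using cV by (auto simp: T_def L_def)
  have i_lt: "i v < ?p" if "v \<in> L" for v using i that by (auto simp: bij_betw_def)
  have j_lt: "j (block v) < ?q" if "v \<in> T" for v using j that by (auto simp: bij_betw_def)
  have i_eq: "i u = i v \<longleftrightarrow> u = v" if "u \<in> L" "v \<in> L" for u v
    using i that by (auto simp: bij_betw_def dest: inj_onD)
  have j_eq: "j (block u) = j (block v) \<longleftrightarrow> block u = block v" if "u \<in> T" "v \<in> T" for u v
    using j that by (auto simp: bij_betw_def dest: inj_onD)
  \<comment> \<open>A block has at most two elements and its representative is one of them, so a vertex is
     determined by its block and by whether it is the representative.\<close>
  have same: "u = v" if "u \<in> T" "v \<in> T" "block u = block v"
    "u = rep (block v) \<longleftrightarrow> v = rep (block v)" for u v
  proof -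
    from T[OF that(1)] obtain w where "block u = {u, w}" by blast
    moreover have "v \<in> block v" by (simp add: block_def)
    ultimately show ?thesis using that rep[of v] by auto
  qed
  have "inj_on f (pverts A)"
    unfolding inj_on_def V using same
    by (auto simp: f_c f_L f_T i_eq j_eq split: if_splits)
  moreover have "f ` pverts A = pverts (firefly_graph ?p ?q)"
  proof (intro equalityI subsetI)
    fix y assume "y \<in> f ` pverts A"
    then show "y \<in> pverts (firefly_graph ?p ?q)"
      unfolding V pverts_firefly_graph by (auto simp: f_c f_L f_T i_lt j_lt)
  next
    fix y assume "y \<in> pverts (firefly_graph ?p ?q)"
    then consider "y = Inl 0" | k where "k < ?p" "y = Inr (Inl (k, 0))"
      | k s where "k < ?q" "s < 2" "y = Inr (Inr (k, s))"
      unfolding pverts_firefly_graph by auto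
    then show "y \<in> f ` pverts A"
    proof cases
      case 1
      then show ?thesis using f_c V by (auto intro: image_eqI[of _ _ c])
    next
      case 2
      then obtain v where "v \<in> L" "i v = k"
        using i unfolding bij_betw_def by (metis imageE lessThan_iff)
      with 2 show ?thesis using f_L V by (auto intro: image_eqI[of _ _ v])
    next
      case 3
      then obtain v where v: "v \<in> T" "j (block v) = k"
        using j unfolding bij_betw_def by (metis (no_types, lifting) imageE lessThan_iff)
      from T[OF v(1)] obtain w where w: "w \<in> T" "w \<noteq> v" "block v = {v, w}" "block w = {v, w}"
        by blast
      define r where "r = rep (block v)"
      have r: "r = v \<or> r = w" using rep[of v] w by (simp add: r_def)
      have fv: "f v = Inr (Inr (k, if v = r then 0 else 1))"
        and fw: "f w = Inr (Inr (k, if w = r then 0 else 1))"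
        using f_T[OF v(1)] f_T[OF w(1)] v w by (simp_all add: r_def)
      have "s = 0 \<or> s = 1" using 3 by auto
      then have "y = f v \<or> y = f w" using fv fw r w(2) 3 by auto
      then show ?thesis using v w V by auto
    qed
  qed
  moreover have "(u, v) \<in> ?E \<longleftrightarrow> (f u, f v) \<in> parcs (firefly_graph ?p ?q)"
    if u: "u \<in> pverts A" and v: "v \<in> pverts A" for u v
  proof -
    have fV: "f x \<in> pverts (firefly_graph ?p ?q)" if "x \<in> pverts A" for x
      using that calculation(2) by blast
    have noL: "(x, y) \<notin> ?E" "(y, x) \<notin> ?E" if "x \<in> L" "y \<in> L \<union> T" for x y
      using that symD[OF sym, of y x] unfolding L_def T_def by auto
    have dom': "(c, x) \<in> ?E" "(x, c) \<in> ?E" if "x \<in> L \<union> T" for x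
      using dom that by (auto simp: L_def T_def)
    have cc: "(c, c) \<notin> ?E" using irr by (simp add: irrefl_def)
    consider "u = c" "v = c" | "u = c" "v \<in> L \<union> T" | "u \<in> L \<union> T" "v = c"
      | "u \<in> L" "v \<in> L \<union> T" | "u \<in> L \<union> T" "v \<in> L" | "u \<in> T" "v \<in> T"
      using u v V by blast
    then show ?thesis
    proof cases
      case 1
      then show ?thesis using cc by (simp add: f_c parcs_firefly_graph_simps)
    next
      case 2
      then show ?thesis using dom' fV[OF v]
        by (auto simp: f_c f_L f_T parcs_firefly_graph_simps)
    next
      case 3
      then show ?thesis using dom' fV[OF u]
        by (auto simp: f_c f_L f_T parcs_firefly_graph_simps)
    next
      case 4
      then show ?thesis using noL by (auto simp: f_L f_T parcs_firefly_graph_simps)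
    next
      case 5
      then show ?thesis using noL by (auto simp: f_L f_T parcs_firefly_graph_simps)
    next
      case 6
      then show ?thesis
        using same[OF 6] block_T[OF 6]
        by (auto simp: f_T parcs_firefly_graph_simps j_eq j_lt)
    qed
  qed
  ultimately have "digraph_iso (with_proj A) (with_proj (firefly_graph ?p ?q))"
    unfolding digraph_iso_pair_graph_iff[OF A pair_graph_firefly] bij_betw_def by blast
  moreover have "L \<noteq> {}" "T \<noteq> {}"
    using c unfolding firefly_centre_def T_def L_def by blast+
  then have "1 \<le> ?p" "1 \<le> ?q"
    using \<open>finite L\<close> \<open>finite (block ` T)\<close> by (simp_all add: Suc_le_eq card_gt_0_iff)
  ultimately show ?thesis by (intro that)
qed

theorem firefly_type_iff:
  assumes "pair_graph A"
  shows "firefly_type A \<longleftrightarrow> (\<exists>c. firefly_centre A c)"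
proof
  assume "firefly_type A"
  then obtain n p where np: "1 \<le> p" "p \<le> n - 1"
    and iso: "digraph_iso (with_proj A) (with_proj (firefly_graph p (n - p)))"
    unfolding firefly_type_def by blast
  let ?F = "firefly_graph p (n - p)"
  from iso obtain f where f: "bij_betw f (pverts A) (pverts ?F)"
    "\<And>u v. u \<in> pverts A \<Longrightarrow> v \<in> pverts A \<Longrightarrow> (u, v) \<in> parcs A \<longleftrightarrow> (f u, f v) \<in> parcs ?F"
    unfolding digraph_iso_pair_graph_iff[OF assms pair_graph_firefly] by blast
  have "Inl 0 \<in> f ` pverts A"
    using f(1) by (simp add: bij_betw_def pverts_firefly_graph)
  then obtain c where c: "c \<in> pverts A" "f c = Inl 0" by force
  have "firefly_centre ?F (f c)"
    using np c firefly_centre_firefly_graph by simp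
  then show "\<exists>c. firefly_centre A c"
    using firefly_centre_iso[OF f c(1)] by blast
next
  assume "\<exists>c. firefly_centre A c"
  then obtain p q where "1 \<le> p" "1 \<le> q"
    "digraph_iso (with_proj A) (with_proj (firefly_graph p q))"
    using iso_firefly_graph_if_firefly_centre[OF assms] by metis
  then show "firefly_type A"
    unfolding firefly_type_def by (intro exI[of _ "p + q"] exI[of _ p]) simp
qed

text \<open>
  A vertex \<open>d\<close> other than the centre has at most one neighbour off the centre, but an isolated
  vertex and the two ends of an isolated edge are three vertices off the centre, at least two of
  which differ from \<open>d\<close>.
\<close>
lemma firefly_centre_unique:
  assumes c: "firefly_centre A c" and d: "d \<in> pverts A"
    and dom: "\<And>v. v \<in> pverts A - {d} \<Longrightarrow> (d, v) \<in> parcs A"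
    and A: "pair_graph A"
  shows "d = c"
proof (rule ccontr)
  assume "d \<noteq> c"
  have uniq: "x = y" if "x \<in> pverts A - {c, d}" "y \<in> pverts A - {c, d}" for x y
  proof -
    have "{d, x, y} \<subseteq> pverts A - {c}" "(d, x) \<in> parcs A" "(d, y) \<in> parcs A"
      using that d dom \<open>d \<noteq> c\<close> by auto
    then show ?thesis
      using c unfolding firefly_centre_def by blast
  qed
  have "\<exists>l \<in> pverts A - {c}. \<forall>w \<in> pverts A - {c}. (l, w) \<notin> parcs A"
    and "\<exists>u \<in> pverts A - {c}. \<exists>v \<in> pverts A - {c}. (u, v) \<in> parcs A"
    using c by (simp_all only: firefly_centre_def)
  then obtain l u v where l: "l \<in> pverts A - {c}" "\<forall>w \<in> pverts A - {c}. (l, w) \<notin> parcs A"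
    and uv: "u \<in> pverts A - {c}" "v \<in> pverts A - {c}" "(u, v) \<in> parcs A"
    by metis
  have "u \<noteq> v" "(v, u) \<in> parcs A"
    using uv(3) A by (auto simp: pair_graph_iff irrefl_def dest: symD)
  with l(2) uv have "l \<noteq> u" "l \<noteq> v" by auto
  with \<open>u \<noteq> v\<close> have "d \<notin> {l, u} \<or> d \<notin> {l, v} \<or> d \<notin> {u, v}" by auto
  then show False
    using l(1) uv(1,2) \<open>u \<noteq> v\<close> \<open>l \<noteq> u\<close> \<open>l \<noteq> v\<close> uniq[of l u] uniq[of l v] uniq[of u v] by auto
qed

section \<open>Elements of order two and three\<close>

context group
begin

lemma ord_eq_2_iff_inv:
  assumes "x \<in> carrier G" "x \<noteq> \<one>"
  shows "ord x = 2 \<longleftrightarrow> inv x = x"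
proof -
  have "inv x = x \<longleftrightarrow> x [^] (2::nat) = \<one>"
    using assms inv_equality[of x x] l_inv[of x]
    by (intro iffI) (simp_all add: numeral_2_eq_2)
  also have "\<dots> \<longleftrightarrow> ord x dvd 2"
    using pow_eq_id assms by simp
  also have "\<dots> \<longleftrightarrow> ord x = 2"
    using assms ord_eq_1[of x] prime_nat_iff[of 2] two_is_prime_nat by (metis dvd_refl)
  finally show ?thesis by simp
qed

lemma inv_in_generate:
  "inv x \<in> generate G {x}"
  by (rule generate.inv) simp

lemma generate_ord_2_3:
  assumes x: "x \<in> carrier G" "ord x \<in> {2, 3}"
  shows "generate G {x} = {\<one>, x, inv x}"
proof -
  have card: "card (generate G {x}) = ord x"
    using generate_pow_card x by simp
  then have fin: "finite (generate G {x})"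
    using x by (auto intro: card_ge_0_finite)
  have sub: "{\<one>, x, inv x} \<subseteq> generate G {x}"
    using generate.one generate.incl[of x "{x}" G] inv_in_generate by auto
  have "x \<noteq> \<one>" using x by auto
  then have "inv x \<noteq> \<one>" using x by (metis inv_inv inv_one)
  have "card {\<one>, x, inv x} = ord x"
    using x ord_eq_2_iff_inv[of x] \<open>x \<noteq> \<one>\<close> \<open>inv x \<noteq> \<one>\<close>
    by (cases "inv x = x") (auto simp: card_insert_if eq_commute[of "\<one>"])
  then show ?thesis
    using card_subset_eq[OF fin sub] card by simp
qed

section \<open>Power graphs\<close>

lemma one_dominates_power_graph:
  "v \<in> carrier G \<Longrightarrow> v \<noteq> \<one> \<Longrightarrow> (\<one>, v) \<in> parcs (power_graph G)"
  by (auto simp: power_graph_def generate.one)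

text \<open>
  With all orders 2 or 3, the only element of \<open>\<langle>u\<rangle>\<close> that can differ from \<open>u\<close> and the identity is
  \<open>u\<^sup>-\<^sup>1\<close>. Loops are excluded, so an involution has no neighbour besides the identity.
\<close>
lemma power_graph_arc_iff_inv:
  assumes ords: "ord ` (carrier G - {\<one>}) \<subseteq> {2, 3}"
    and uv: "u \<in> carrier G - {\<one>}" "v \<in> carrier G - {\<one>}"
  shows "(u, v) \<in> parcs (power_graph G) \<longleftrightarrow> v = inv u \<and> ord u = 3"
proof -
  have "generate G {u} = {\<one>, u, inv u}" "generate G {v} = {\<one>, v, inv v}"
    using ords uv by (auto intro!: generate_ord_2_3)
  then have "(u, v) \<in> parcs (power_graph G) \<longleftrightarrow> u \<noteq> v \<and> (v = inv u \<or> u = inv v)"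
    using uv by (auto simp: power_graph_def)
  also have "\<dots> \<longleftrightarrow> v = inv u \<and> inv u \<noteq> u"
    using uv by auto
  also have "\<dots> \<longleftrightarrow> v = inv u \<and> ord u = 3"
    using ords uv ord_eq_2_iff_inv[of u] by fastforce
  finally show ?thesis .
qed

text \<open>
  Counting gives the orders: \<open>\<langle>x\<rangle>\<close> consists of the identity, \<open>x\<close>, and neighbours of \<open>x\<close> other than
  the identity, of which there is at most one. Once the orders are known to be 2 or 3, an isolated
  vertex cannot have order 3 and the end of an isolated edge must have it.
\<close>
lemma ords_if_firefly_centre_power_graph:
  assumes fin: "finite (carrier G)" and c: "firefly_centre (power_graph G) c"
  shows "ord ` (carrier G - {\<one>}) = {2, 3}"
proof -
  let ?P = "power_graph G"
  have V: "pverts ?P = carrier G" by (simp add: power_graph_def)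
  have "\<one> = c"
    using firefly_centre_unique[OF c _ _ pair_graph_power_graph[OF fin], of \<one>]
      one_dominates_power_graph by (simp add: V)
  with c have uniq: "\<And>v u w. {v, u, w} \<subseteq> carrier G - {\<one>} \<Longrightarrow> (v, u) \<in> parcs ?P \<Longrightarrow>
      (v, w) \<in> parcs ?P \<Longrightarrow> u = w"
    and ex: "\<exists>v \<in> carrier G - {\<one>}. \<forall>w \<in> carrier G - {\<one>}. (v, w) \<notin> parcs ?P"
      "\<exists>u \<in> carrier G - {\<one>}. \<exists>v \<in> carrier G - {\<one>}. (u, v) \<in> parcs ?P"
    unfolding firefly_centre_def V by blast+
  have gen: "generate G {x} \<subseteq> carrier G" if "x \<in> carrier G" for x
    using generate_incl that by simp
  have ords: "ord x \<in> {2, 3}" if x: "x \<in> carrier G - {\<one>}" for x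
  proof -
    have "x \<in> generate G {x}" "\<one> \<in> generate G {x}"
      using generate.incl[of x "{x}" G] generate.one by auto
    then have "card {\<one>, x} \<le> card (generate G {x})"
      and "card (generate G {x} - {\<one>, x}) = card (generate G {x}) - card {\<one>, x}"
      using finite_subset[OF gen[of x] fin] x by (auto intro!: card_mono card_Diff_subset)
    moreover have "card {\<one>, x} = 2" using x by auto
    moreover have "card (generate G {x} - {\<one>, x}) \<le> 1"
    proof (subst One_nat_def, subst card_le_Suc0_iff_eq)
      show "finite (generate G {x} - {\<one>, x})"
        using x fin gen[of x] by (auto intro: finite_subset)
      show "\<forall>u\<in>generate G {x} - {\<one>, x}. \<forall>w\<in>generate G {x} - {\<one>, x}. u = w"
        using x gen[of x] by (intro ballI uniq[of x]) (auto simp: power_graph_def)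
    qed
    ultimately show ?thesis
      using generate_pow_card[of x] x by (simp; linarith)
  qed
  then have sub: "ord ` (carrier G - {\<one>}) \<subseteq> {2, 3}" by blast
  note arc = power_graph_arc_iff_inv[OF sub]
  from ex(1) obtain v where v: "v \<in> carrier G - {\<one>}"
    "\<And>w. w \<in> carrier G - {\<one>} \<Longrightarrow> (v, w) \<notin> parcs ?P" by blast
  have "inv v \<in> carrier G - {\<one>}" using v(1) by (auto simp: inv_eq_1_iff)
  then have "ord v = 2"
    using arc[OF v(1)] v ords[OF v(1)] by blast
  moreover from ex(2) obtain u where "u \<in> carrier G - {\<one>}" "ord u = 3"
    using arc by blast
  ultimately show ?thesis using sub v(1) by force
qed

lemma firefly_centre_power_graph_if_ords:
  assumes ords: "ord ` (carrier G - {\<one>}) = {2, 3}"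
  shows "firefly_centre (power_graph G) \<one>"
proof -
  note arc = power_graph_arc_iff_inv[OF equalityD1[OF ords]]
  have "2 \<in> ord ` (carrier G - {\<one>})"
    unfolding ords by simp
  then obtain x where x: "x \<in> carrier G - {\<one>}" "ord x = 2"
    by (elim imageE) simp
  have "3 \<in> ord ` (carrier G - {\<one>})"
    unfolding ords by simp
  then obtain y where y: "y \<in> carrier G - {\<one>}" "ord y = 3"
    by (elim imageE) simp
  have "\<exists>v \<in> carrier G - {\<one>}. \<forall>w \<in> carrier G - {\<one>}. (v, w) \<notin> parcs (power_graph G)"
    using arc x by (intro bexI[of _ x]) simp_all
  moreover have "inv y \<in> carrier G - {\<one>}" using y by (auto simp: inv_eq_1_iff)
  then have "\<exists>u \<in> carrier G - {\<one>}. \<exists>v \<in> carrier G - {\<one>}. (u, v) \<in> parcs (power_graph G)"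
    using arc y by (intro bexI[of _ y] bexI[of _ "inv y"]) simp_all
  moreover have "\<forall>v u w. {v, u, w} \<subseteq> carrier G - {\<one>} \<and>
      (v, u) \<in> parcs (power_graph G) \<and> (v, w) \<in> parcs (power_graph G) \<longrightarrow> u = w"
    using arc by (metis insert_subset)
  moreover have "\<forall>v \<in> carrier G - {\<one>}. (\<one>, v) \<in> parcs (power_graph G)"
    using one_dominates_power_graph by simp
  moreover have "pverts (power_graph G) = carrier G" by (simp add: power_graph_def)
  ultimately show ?thesis
    unfolding firefly_centre_def by (simp only: one_closed simp_thms)
qed

end

section \<open>Groups whose power graph is of firefly type\<close>

theorem theorem3p2:
  fixes G :: "('a, 'b) monoid_scheme"
  assumes "group G" and "finite (carrier G)"
  shows "firefly_type (power_graph G) \<longleftrightarrow>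
    group.ord G ` (carrier G - {\<one>\<^bsub>G\<^esub>}) = {2, 3}"
proof -
  interpret group G by fact
  show ?thesis
    unfolding firefly_type_iff[OF pair_graph_power_graph[OF assms(2)]]
  proof
    assume "\<exists>c. firefly_centre (power_graph G) c"
    then obtain c where "firefly_centre (power_graph G) c" ..
    then show "ord ` (carrier G - {\<one>\<^bsub>G\<^esub>}) = {2, 3}"
      by (rule ords_if_firefly_centre_power_graph[OF assms(2)])
  next
    assume "ord ` (carrier G - {\<one>\<^bsub>G\<^esub>}) = {2, 3}"
    then have "firefly_centre (power_graph G) \<one>\<^bsub>G\<^esub>"
      by (rule firefly_centre_power_graph_if_ords)
    then show "\<exists>c. firefly_centre (power_graph G) c" ..
  qed
qed

end
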